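(* Let $T_n(x)=\frac{a_0}{2}+\sum_{l=1}^{n}\bigl(a_l\cos(lx)+b_l\sin(lx)\bigr)$ be a trigonometric polynomial for which at least one of the leading coefficients $a_n,b_n$ is nonzero, and which has real roots $x_1,\dots,x_m$ with given multiplicities $\alpha_1,\dots,\alpha_m$, where $\alpha_1+\dots+\alpha_m=2n$. Let $d=\min_{i\ne j}|x_i-x_j|$. Let $c$, $q$ and $\xi$ be positive real numbers such that $q<1$, $2c<\xi$, $d-2c>0$ and $\max_{i\neq j}|x_i-x_j|<2\pi-2\xi$. Put $$A=\min\bigl\{|\sin(\xi/2)|,\ |\sin(d/2-c)|\bigr\}.$$ Suppose that $$c^2\bigl(4n+\alpha_i(9A^2/8-2)\bigr)<A^2\alpha_i,\qquad i=1,\dots,m,$$ and that the initial approximations $x_i^{[0]}$ are chosen so that $|x_i^{[0]}-x_i|\le cq$ for $i=1,\dots,m$. Let the sequences $x_i^{[k]}$ be generated by $$x_i^{[k+1]}=x_i^{[k]}-\alpha_i T_n\bigl(x_i^{[k]}\bigr)\left[T_n'\bigl(x_i^{[k]}\bigr)-T_n\bigl(x_i^{[k]}\bigr)\frac{Q_i'^{[k]}\bigl(x_i^{[k]}\bigr)}{Q_i^{[k]}\bigl(x_i^{[k]}\bigr)}\right]^{-1},\qquad i=1,\dots,m,\ k=0,1,2,\dots,$$ where $$Q_i^{[k]}(x)=\prod_{j=1,\,j\ne i}^{m}\sin^{\alpha_j}\!\left(\frac{x-x_j^{[k]}}{2}\right).$$ Then for every natural number $k$ the inequalities $$\bigl|x_i^{[k]}-x_i\bigr|\le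 c\,q^{3^k},\qquad i=1,\dots,m,$$ hold true.
   Context: The coefficients $a_l,b_l$ are real. The real roots $x_1,\dots,x_m$ are pairwise distinct and $\alpha_i$ is the multiplicity of $x_i$ as a root of $T_n$. The initial approximations are real. The notation $Q_i'^{[k]}$ denotes the derivative with respect to $x$ of the function $Q_i^{[k]}$; $x_i^{[k]}$ denotes the $k$-th approximation to $x_i$. *)

theory Defs
  imports "HOL-Analysis.Analysis"
begin

definition trig_poly :: "(nat \<Rightarrow> real) \<Rightarrow> (nat \<Rightarrow> real) \<Rightarrow> nat \<Rightarrow> real \<Rightarrow> real" where
  "trig_poly a b n x =
     a 0 / 2 + (\<Sum>l=1..n. a l * cos (real l * x) + b l * sin (real l * x))"

definition root_of_multiplicity :: "(real \<Rightarrow> real) \<Rightarrow> real \<Rightarrow> nat \<Rightarrow> bool" where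
  "root_of_multiplicity f z k \<longleftrightarrow>
     k \<ge> 1 \<and> (\<forall>j<k. (deriv ^^ j) f z = 0) \<and> (deriv ^^ k) f z \<noteq> 0"

text \<open>For m < 2 the following set is empty, so its \<^const>\<open>Min\<close> and \<^const>\<open>Max\<close> are unspecified values.\<close>

definition pairwise_distances :: "nat \<Rightarrow> (nat \<Rightarrow> real) \<Rightarrow> real set" where
  "pairwise_distances m x =
     {\<bar>x i - x j\<bar> | i j. i \<in> {1..m} \<and> j \<in> {1..m} \<and> i \<noteq> j}"

definition Q :: "nat \<Rightarrow> (nat \<Rightarrow> nat) \<Rightarrow> (nat \<Rightarrow> real) \<Rightarrow> nat \<Rightarrow> real \<Rightarrow> real" where
  "Q m \<alpha> y i x = (\<Prod>j\<in>{1..m} - {i}. sin ((x - y j) / 2) ^ \<alpha> j)"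

text \<open>One step, from the vector y of current approximations to the next approximation of the i-th
  root. If y i is already an exact root, then the correction is 0 even where the bracket vanishes
  (which happens at a multiple root), because \<^prop>\<open>inverse (0::real) = 0\<close>.\<close>

definition iteration_step ::
  "(real \<Rightarrow> real) \<Rightarrow> nat \<Rightarrow> (nat \<Rightarrow> nat) \<Rightarrow> (nat \<Rightarrow> real) \<Rightarrow> nat \<Rightarrow> real" where
  "iteration_step T m \<alpha> y i =
     y i - real (\<alpha> i) * T (y i) *
       inverse (deriv T (y i) - T (y i) * (deriv (Q m \<alpha> y i) (y i) / Q m \<alpha> y i (y i)))"

end

theory Submission
  imports
    Defs
    "HOL-Computational_Algebra.Field_as_Ring"
    "HOL-Computational_Algebra.Polynomial_Factorial"
begin

text \<open>A trigonometric polynomial of degree \<open>n\<close> is \<open>e\<^sup>-\<^sup>i\<^sup>n\<^sup>x p(e\<^sup>i\<^sup>x)\<close> for a complex polynomial \<open>p\<close> of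
  degree at most \<open>2n\<close>. Its \<open>2n\<close> real roots exhaust the roots of \<open>p\<close>, so it equals
  \<open>C \<Prod> sin\<close>-powers of \<open>(x - x\<^sub>j)/2\<close>, with logarithmic derivative \<open>\<Sum> (\<alpha>\<^sub>j/2) cot ((x - x\<^sub>j)/2)\<close>.
  One step therefore maps the error \<open>e\<close> of the \<open>i\<close>-th root to \<open>e - 2/(cot (e/2) + s)\<close>, where \<open>s\<close> is a
  sum of cotangent differences of the order of the other errors. Since \<open>e - 2 tan (e/2) = O(e\<^sup>3)\<close> and
  \<open>s e tan (e/2) = O(\<epsilon>\<^sup>3)\<close> when all errors are at most \<open>\<epsilon>\<close>, convergence is cubic.\<close>

section \<open>Scalar estimates for the error after one step\<close>

text \<open>On \<open>[0, 1/2]\<close> the upper bound amounts to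
  \<open>sin v <= v <= (v + v^3) * cos v\<close>. Since \<open>cos v >= 1 - v^2/2\<close>, it rests
  on \<open>(1 + v^2) * (1 - v^2/2) >= 1\<close>. Negative arguments follow by oddness.\<close>

lemma abs_tan_minus_self_le:
  fixes u :: real
  assumes "\<bar>u\<bar> \<le> 1/2"
  shows "\<bar>tan u - u\<bar> \<le> \<bar>u\<bar> ^ 3"
proof -
  have pos: "\<bar>tan v - v\<bar> \<le> v ^ 3" if v: "0 \<le> v" "v \<le> 1/2" for v :: real
  proof -
    have vp: "v < pi / 2" using v pi_gt3 by linarith
    have lower: "v \<le> tan v"
      using vp v(1) abs_tan_ge[of v] tan_pos_pi2_le[of v] by simp
    have v2: "v\<^sup>2 \<le> 1/4"
      using power_mono[of v "1/2" 2] v by (simp add: power2_eq_square)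
    have cos: "1 - v\<^sup>2 / 2 \<le> cos v"
      using cos_double_sin[of "v/2"] sin_x_le_x[of "v/2"] sin_ge_zero[of "v/2"] v vp
        power_mono[of "sin (v/2)" "v/2" 2] by (simp add: power2_eq_square)
    have "v\<^sup>2 * v\<^sup>2 \<le> v\<^sup>2 * (1/4)" by (intro mult_left_mono v2) auto
    then have "1 \<le> (1 + v\<^sup>2) * (1 - v\<^sup>2 / 2)"
      using zero_le_power2[of v] unfolding distrib_right right_diff_distrib mult_1 mult_1_right
      by linarith
    also have "\<dots> \<le> (1 + v\<^sup>2) * cos v" by (intro mult_left_mono cos) auto
    finally have "v * 1 \<le> v * ((1 + v\<^sup>2) * cos v)" by (intro mult_left_mono v)
    then have "sin v \<le> (v + v ^ 3) * cos v"
      using sin_x_le_x[OF v(1)] by (simp add: algebra_simps power2_eq_square power3_eq_cube)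
    moreover have "cos v > 0" using v vp by (intro cos_gt_zero_pi) auto
    ultimately have "tan v \<le> v + v ^ 3"
      unfolding tan_def by (simp add: pos_divide_le_eq)
    then show ?thesis using lower by simp
  qed
  show ?thesis
  proof (cases "u \<ge> 0")
    case True then show ?thesis using pos[of u] assms by simp
  next
    case False then show ?thesis using pos[of "-u"] assms by (simp add: abs_minus_commute)
  qed
qed

text \<open>With \<open>t = tan (e/2)\<close> the new error is
  \<open>(e - 2*t + s*t*e) / (1 + s*t)\<close>: both \<open>e - 2*t\<close> and \<open>s*t*e\<close>
  are cubic in \<open>\<epsilon>\<close>, and the denominator stays away from 0. The constant
  \<open>2*B + 9/8\<close> is generous; it matches the smallness condition on \<open>c\<close> in
  the theorem.\<close>

lemma iteration_error_bound:
  fixes e s \<epsilon> B :: real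
  assumes e: "e \<noteq> 0" "\<bar>e\<bar> \<le> \<epsilon>" and s: "\<bar>s\<bar> \<le> B * \<epsilon> / 2" and "B \<ge> 0"
    and small: "\<epsilon>\<^sup>2 * (2 * B + 9/8) < 1"
  shows "\<bar>e - 2 / (cot (e / 2) + s)\<bar> \<le> (2 * B + 9/8) * \<epsilon> ^ 3"
proof -
  define t where "t = tan (e / 2)"
  have \<epsilon>: "\<epsilon> > 0" using e by linarith
  have B\<epsilon>: "0 \<le> B * \<epsilon>\<^sup>2" using \<open>B \<ge> 0\<close> by simp
  have "\<epsilon>\<^sup>2 < 1" using small B\<epsilon> by (simp add: algebra_simps)
  then have "\<epsilon> < 1" using \<epsilon> by (simp add: power_less_one_iff)
  then have e2: "\<bar>e / 2\<bar> \<le> 1/2" using e by simp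
  have "\<bar>e / 2\<bar>^3 \<le> (\<epsilon>/2)^3" by (intro power_mono) (use e in auto)
  moreover have "\<bar>e - 2 * t\<bar> = 2 * \<bar>t - e / 2\<bar>" by (auto simp: abs_if)
  ultimately have t1: "\<bar>e - 2 * t\<bar> \<le> \<epsilon>^3 / 4"
    using abs_tan_minus_self_le[OF e2] by (simp add: t_def power_divide)
  have "\<epsilon>^3 \<le> \<epsilon>" using power_decreasing[of 1 3 \<epsilon>] \<epsilon> \<open>\<epsilon> < 1\<close> by simp
  \<comment> \<open>From \<open>2*|t| <= |e| + \<epsilon>^3/4 <= (5/4)*\<epsilon>\<close>.\<close>
  then have t2: "\<bar>t\<bar> \<le> (5/8) * \<epsilon>" using t1 e by linarith
  have t0: "t \<noteq> 0"
    using abs_tan_ge[of "e/2"] e e2 pi_gt3 by (auto simp: t_def)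
  have st: "\<bar>s * t\<bar> \<le> 5/16 * (B * \<epsilon>\<^sup>2)"
    using mult_mono[OF s t2] \<open>B \<ge> 0\<close> \<epsilon> by (simp add: abs_mult power2_eq_square mult_ac)
  have "2 * (B * \<epsilon>\<^sup>2) \<le> \<epsilon>\<^sup>2 * (2 * B + 9/8)" by (simp add: algebra_simps)
  then have "2 * (B * \<epsilon>\<^sup>2) < 1" using small by linarith
  then have st2: "\<bar>s * t\<bar> < 1/6" using st by linarith
  have "\<bar>s * t * e\<bar> \<le> 5/16 * (B * \<epsilon>\<^sup>2) * \<epsilon>"
    unfolding abs_mult[of "s*t"] by (intro mult_mono st e) (use B\<epsilon> in auto)
  then have "\<bar>e - 2 * t + s * t * e\<bar> \<le> (5/16 * B + 1/4) * \<epsilon>^3"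
    using t1 abs_triangle_ineq[of "e - 2 * t" "s * t * e"]
    by (simp add: algebra_simps power2_eq_square power3_eq_cube)
  \<comment> \<open>The factor 5/6 is the lower bound for \<open>1 + s*t\<close> that
    \<open>|s*t| < 1/6\<close> provides.\<close>
  also have "\<dots> \<le> ((2 * B + 9/8) * \<epsilon>^3) * (5/6)"
    using \<open>B \<ge> 0\<close> \<epsilon> mult_nonneg_nonneg[of B "\<epsilon>^3"] zero_le_power[of \<epsilon> 3]
    unfolding distrib_right by linarith
  also have "\<dots> \<le> ((2 * B + 9/8) * \<epsilon>^3) * (1 + s * t)"
    by (intro mult_left_mono) (use \<open>B \<ge> 0\<close> \<epsilon> st2 in auto)
  finally have "\<bar>(e - 2 * t + s * t * e) / (1 + s * t)\<bar> \<le> (2 * B + 9/8) * \<epsilon> ^ 3"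
    using st2 by (simp add: abs_divide pos_divide_le_eq)
  moreover have "e - 2 / (cot (e / 2) + s) = (e - 2 * t + s * t * e) / (1 + s * t)"
  proof -
    have cot: "cot (e / 2) + s = (1 + s * t) / t"
      using t0 by (simp add: t_def cot_altdef add_divide_distrib inverse_eq_divide)
    have "1 + s * t \<noteq> 0" using st2 by auto
    then show ?thesis unfolding cot
      by (simp add: eq_divide_eq left_diff_distrib) (simp add: algebra_simps)
  qed
  ultimately show ?thesis by simp
qed

section \<open>Logarithmic derivatives and lower bounds for sines\<close>

lemma DERIV_prod_sin_power:
  fixes w :: "nat \<Rightarrow> real" and \<alpha> :: "nat \<Rightarrow> nat"
  assumes "finite J" and "\<And>j. j \<in> J \<Longrightarrow> sin ((y - w j) / 2) \<noteq> 0"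
  shows "((\<lambda>x. \<Prod>j\<in>J. sin ((x - w j) / 2) ^ \<alpha> j) has_real_derivative
     (\<Prod>j\<in>J. sin ((y - w j) / 2) ^ \<alpha> j) * (\<Sum>j\<in>J. \<alpha> j / 2 * cot ((y - w j) / 2))) (at y)"
  using assms
proof (induction J)
  case empty
  then show ?case by simp
next
  case (insert i J)
  have "((\<lambda>x. sin ((x - w i) / 2) ^ \<alpha> i) has_real_derivative
      sin ((y - w i) / 2) ^ \<alpha> i * (\<alpha> i / 2 * cot ((y - w i) / 2))) (at y)"
    using insert.prems[of i]
    \<comment> \<open>The case \<open>\<alpha> i = 0\<close> is split off because the exponent
      \<open>\<alpha> i - 1\<close> in the derivative is truncated at 0.\<close>
    by (auto intro!: derivative_eq_intros simp: cot_def) (cases "\<alpha> i"; simp)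
  from DERIV_mult[OF this insert.IH] insert.prems
  have "((\<lambda>x. sin ((x - w i) / 2) ^ \<alpha> i * (\<Prod>j\<in>J. sin ((x - w j) / 2) ^ \<alpha> j)) has_real_derivative
      sin ((y - w i) / 2) ^ \<alpha> i * (\<alpha> i / 2 * cot ((y - w i) / 2)) * (\<Prod>j\<in>J. sin ((y - w j) / 2) ^ \<alpha> j)
     + (\<Prod>j\<in>J. sin ((y - w j) / 2) ^ \<alpha> j) * (\<Sum>j\<in>J. \<alpha> j / 2 * cot ((y - w j) / 2))
       * sin ((y - w i) / 2) ^ \<alpha> i) (at y)" by simp
  then show ?case using insert.hyps by (simp add: algebra_simps)
qed

lemma sin_half_nonzero:
  fixes w :: real
  assumes "0 < \<bar>w\<bar>" "\<bar>w\<bar> < 2 * pi"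
  shows "sin (w / 2) \<noteq> 0"
proof -
  have "- pi < w / 2" "w / 2 < pi" "w \<noteq> 0" using assms by linarith+
  then show ?thesis using sin_eq_0_pi[of "w / 2"] by auto
qed

lemma cot_diff:
  fixes u v :: real
  assumes "sin u \<noteq> 0" "sin v \<noteq> 0"
  shows "cot u - cot v = sin (v - u) / (sin u * sin v)"
  using assms by (simp add: cot_def sin_diff field_simps)

text \<open>Sine rises up to \<open>pi/2\<close> and is symmetric about it, so on
  \<open>[p, pi - r]\<close> it is smallest at an endpoint.\<close>

lemma min_sin_le_sin:
  fixes p r u :: real
  assumes "0 \<le> p" "p \<le> u" "u \<le> pi - r" "0 \<le> r"
  shows "min (sin p) (sin r) \<le> sin u"
proof (cases "u \<le> pi / 2")
  case True
  then have "sin p \<le> sin u" using assms by (intro sin_monotone_2pi_le) auto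
  then show ?thesis by simp
next
  case False
  then have "sin r \<le> sin (pi - u)" using assms by (intro sin_monotone_2pi_le) auto
  then show ?thesis by simp
qed

section \<open>Factorization of a trigonometric polynomial with 2n real roots\<close>

text \<open>The representation by a polynomial in \<open>cis x\<close> survives differentiation with
  the same \<open>n\<close>, so an induction over iterated derivatives can be carried out on
  polynomials. The derivative is taken in the complex plane and restricted to the real line; as
  \<open>f\<close> is real, its imaginary part vanishes.\<close>

lemma deriv_cis_poly:
  fixes f :: "real \<Rightarrow> real" and p :: "complex poly"
  assumes f: "\<And>x. complex_of_real (f x) = cis (- (real n * x)) * poly p (cis x)"
  shows "complex_of_real (deriv f x) =
     cis (- (real n * x)) * poly (smult \<i> ([:0, 1:] * pderiv p - smult (of_nat n) p)) (cis x)"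
proof -
  define D where "D = cis (- (real n * x)) * poly (smult \<i> ([:0, 1:] * pderiv p - smult (of_nat n) p)) (cis x)"
  have "((\<lambda>w. exp (- (\<i> * (of_nat n * w))) * poly p (exp (\<i> * w))) has_field_derivative D)
      (at (complex_of_real x))"
    unfolding D_def cis_conv_exp
    by (auto intro!: derivative_eq_intros DERIV_chain2[OF poly_DERIV] simp: algebra_simps)
  from has_vector_derivative_real_field[OF this]
  have "((\<lambda>x. exp (\<i> * complex_of_real (- (real n * x))) * poly p (exp (\<i> * complex_of_real x)))
     has_vector_derivative D) (at x)" by simp
  then have D: "((\<lambda>x. complex_of_real (f x)) has_vector_derivative D) (at x)"
    by (simp add: f cis_conv_exp)
  have "(f has_real_derivative Re D) (at x)"
    using bounded_linear.has_vector_derivative[OF bounded_linear_Re D]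
    by (simp add: has_real_derivative_iff_has_vector_derivative)
  moreover have "Im D = 0"
    using bounded_linear.has_vector_derivative[OF bounded_linear_Im D]
    by (simp add: DERIV_const DERIV_unique flip: has_real_derivative_iff_has_vector_derivative)
  ultimately show ?thesis
    by (simp add: DERIV_imp_deriv complex_eq_iff D_def)
qed

lemma coprime_linear:
  fixes c d :: "'a :: field_gcd"
  assumes "c \<noteq> d"
  shows "coprime [:- c, 1:] [:- d, 1:]"
proof (rule coprimeI)
  fix r assume "r dvd [:- c, 1:]" "r dvd [:- d, 1:]"
  from dvd_diff[OF this] have "r dvd [:d - c:]" by simp
  also have "[:d - c:] dvd 1" using assms by (simp add: is_unit_triv)
  finally show "is_unit r" .
qed

lemma prod_dvd_of_coprime:
  fixes f :: "'a \<Rightarrow> 'b :: semiring_gcd"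
  assumes "finite J" and "\<And>j. j \<in> J \<Longrightarrow> f j dvd p"
    and "\<And>j k. j \<in> J \<Longrightarrow> k \<in> J \<Longrightarrow> j \<noteq> k \<Longrightarrow> coprime (f j) (f k)"
  shows "prod f J dvd p"
  using assms
proof (induction J)
  case (insert i J)
  have "f i * prod f J dvd p"
    by (intro divides_mult prod_coprime_right insert.IH insert.prems) (use insert.hyps in auto)
  then show ?case using insert.hyps by simp
qed simp

text \<open>Induction on \<open>k\<close>: by hypothesis the \<open>k\<close>-th power divides the
  polynomial \<open>p'\<close> that belongs to \<open>deriv f\<close>. If the order \<open>r\<close>
  of \<open>cis z\<close> in \<open>p\<close> were at most \<open>k\<close>, the \<open>r\<close>-th
  power would divide \<open>p\<close> and \<open>p'\<close>, hence
  \<open>[:0, 1:] * pderiv p\<close>, and hence \<open>pderiv p\<close> because \<open>cis z\<close>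
  is nonzero. But \<open>pderiv p\<close> has order \<open>r - 1\<close> there.\<close>

lemma linear_power_dvd_of_derivs_zero:
  fixes f :: "real \<Rightarrow> real" and p :: "complex poly"
  assumes "\<And>x. complex_of_real (f x) = cis (- (real n * x)) * poly p (cis x)"
    and "\<And>j. j < k \<Longrightarrow> (deriv ^^ j) f z = 0"
  shows "[:- cis z, 1:] ^ k dvd p"
  using assms
proof (induction k arbitrary: f p)
  case 0
  then show ?case by simp
next
  case (Suc k)
  define p' where "p' = smult \<i> ([:0, 1:] * pderiv p - smult (of_nat n) p)"
  have "(deriv ^^ j) (deriv f) z = 0" if "j < k" for j
    using Suc.prems(2)[of "Suc j"] that by (simp add: funpow_swap1)
  with Suc.IH[of "deriv f" p'] deriv_cis_poly[OF Suc.prems(1)]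
  have p': "[:- cis z, 1:] ^ k dvd p'" unfolding p'_def by blast
  show ?case
  proof (cases "p = 0")
    case False
    have root: "poly p (cis z) = 0" using Suc.prems(1)[of z] Suc.prems(2)[of 0] by simp
    define r where "r = order (cis z) p"
    have r: "r > 0" using root False order_root by (metis r_def gr0I)
    have "pderiv p \<noteq> 0"
      using root False by (metis pderiv_iszero poly_pCons poly_0 mult_zero_right add_0_right pCons_0_0)
    then have r': "r = Suc (order (cis z) (pderiv p))"
      using order_pderiv[of p "cis z"] False r r_def root by simp
    have "Suc k \<le> r"
    proof (rule ccontr)
      assume "\<not> Suc k \<le> r"
      then have "[:- cis z, 1:] ^ r dvd p'" using p' by (meson le_imp_power_dvd dvd_trans not_less_eq_eq)
      moreover have rp: "[:- cis z, 1:] ^ r dvd p" unfolding r_def by (rule order_1)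
      ultimately have "[:- cis z, 1:] ^ r dvd smult (- \<i>) p' + smult (of_nat n) p"
        by (intro dvd_add dvd_smult)
      then have "[:- cis z, 1:] ^ r dvd [:0, 1:] * pderiv p"
        by (simp add: p'_def)
      moreover have "coprime ([:- cis z, 1:] ^ r) [:0, 1:]"
        using coprime_linear[of "cis z" 0] by simp
      ultimately have "[:- cis z, 1:] ^ r dvd pderiv p"
        by (metis coprime_dvd_mult_right_iff)
      then show False using r' \<open>pderiv p \<noteq> 0\<close> order_divides by (metis Suc_n_not_le_n)
    qed
    then show ?thesis unfolding r_def
      using order_divides by blast
  qed simp
qed

text \<open>By Euler's formula the \<open>l\<close>-th term is \<open>(a l - \<i> * b l)/2 * cis (l
  * x) + (a l + \<i> * b l)/2 * cis (- l * x)\<close>. Multiplying by \<open>cis (n * x)\<close>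
  shifts the exponents to \<open>n + l\<close> and \<open>n - l\<close>, both between 0 and
  \<open>2 * n\<close>.\<close>

lemma trig_poly_cis:
  "\<exists>p. degree p \<le> 2 * n \<and>
     (\<forall>x. complex_of_real (trig_poly a b n x) = cis (- (real n * x)) * poly p (cis x))"
proof (intro exI conjI allI)
  let ?p = "monom (complex_of_real (a 0 / 2)) n +
    (\<Sum>l=1..n. monom (Complex (a l / 2) (- b l / 2)) (n + l) + monom (Complex (a l / 2) (b l / 2)) (n - l))"
  show "degree ?p \<le> 2 * n"
    by (auto intro!: degree_add_le degree_sum_le order.trans[OF degree_monom_le])
  fix x
  have [simp]: "cis (- (real n * x)) * (c * cis (real n * x)) = c" for c
    by (simp add: cis_mult mult.left_commute[of _ c])
  have l: "complex_of_real (a l * cos (real l * x) + b l * sin (real l * x)) =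
     cis (- (real n * x)) * (Complex (a l / 2) (- b l / 2) * cis (real (n + l) * x)
        + Complex (a l / 2) (b l / 2) * cis (real (n - l) * x))" if "l \<in> {1..n}" for l
  proof -
    have "cis (- (real n * x)) * cis (real (n + l) * x) = cis (real l * x)"
       "cis (- (real n * x)) * cis (real (n - l) * x) = cis (- (real l * x))"
      using that by (simp_all add: cis_mult algebra_simps of_nat_diff)
    then have "cis (- (real n * x)) * (Complex (a l / 2) (- b l / 2) * cis (real (n + l) * x)
        + Complex (a l / 2) (b l / 2) * cis (real (n - l) * x)) =
        Complex (a l / 2) (- b l / 2) * cis (real l * x) + Complex (a l / 2) (b l / 2) * cis (- (real l * x))"
      unfolding distrib_left mult.left_commute[of "cis _" "Complex _ _"] by simp
    then show ?thesis by (simp add: complex_eq_iff)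
  qed
  show "complex_of_real (trig_poly a b n x) = cis (- (real n * x)) * poly ?p (cis x)"
    unfolding trig_poly_def poly_add poly_sum poly_monom Complex.DeMoivre distrib_left sum_distrib_left of_real_add of_real_sum
    using l by (simp add: distrib_left)
qed

text \<open>Pulling out the midpoint phase \<open>cis ((y + w) / 2)\<close> converts a linear factor
  of the polynomial into a half-angle sine.\<close>

lemma cis_diff_eq_sin:
  "cis y - cis w = 2 * \<i> * cis (w / 2) * cis (y / 2) * complex_of_real (sin ((y - w) / 2))"
proof -
  have "cis ((y - w) / 2) - cis (- ((y - w) / 2)) = 2 * \<i> * complex_of_real (sin ((y - w) / 2))"
    by (simp add: complex_eq_iff)
  then have "cis (w / 2) * cis (y / 2) * (cis ((y - w) / 2) - cis (- ((y - w) / 2))) =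
     2 * \<i> * cis (w / 2) * cis (y / 2) * complex_of_real (sin ((y - w) / 2))" by simp
  moreover have "w / 2 + y / 2 + (y - w) / 2 = y" "w / 2 + y / 2 - (y - w) / 2 = w"
    by (simp_all add: field_simps)
  ultimately show ?thesis by (simp add: cis_mult right_diff_distrib)
qed

text \<open>Distinct points \<open>cis (x j)\<close> give pairwise coprime powers of linear factors,
  so their product divides the polynomial. Its degree is already \<open>2 * n\<close>, which leaves
  only a constant cofactor.\<close>

lemma trig_poly_factorization:
  assumes "finite J" and mult: "\<And>j. j \<in> J \<Longrightarrow> root_of_multiplicity (trig_poly a b n) (x j) (\<alpha> j)"
    and inj: "inj_on (\<lambda>j. cis (x j)) J"
    and "(\<Sum>j\<in>J. \<alpha> j) = 2 * n"
  obtains C where "trig_poly a b n = (\<lambda>y. C * (\<Prod>j\<in>J. sin ((y - x j) / 2) ^ \<alpha> j))"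
proof -
  obtain p where deg: "degree p \<le> 2 * n"
    and p: "\<And>x. complex_of_real (trig_poly a b n x) = cis (- (real n * x)) * poly p (cis x)"
    using trig_poly_cis by metis
  have "[:- cis (x j), 1:] ^ \<alpha> j dvd p" if "j \<in> J" for j
    by (rule linear_power_dvd_of_derivs_zero[OF p]) (use mult[OF that] in \<open>auto simp: root_of_multiplicity_def\<close>)
  moreover have "coprime ([:- cis (x j), 1:] ^ \<alpha> j) ([:- cis (x k), 1:] ^ \<alpha> k)"
    if "j \<in> J" "k \<in> J" "j \<noteq> k" for j k
    using that inj coprime_linear[of "cis (x j)" "cis (x k)"] 
    by (auto simp: inj_on_def)
  ultimately have "(\<Prod>j\<in>J. [:- cis (x j), 1:] ^ \<alpha> j) dvd p"
    using \<open>finite J\<close> by (intro prod_dvd_of_coprime) auto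
  then obtain r where r: "p = (\<Prod>j\<in>J. [:- cis (x j), 1:] ^ \<alpha> j) * r" by auto
  have "degree (\<Prod>j\<in>J. [:- cis (x j), 1:] ^ \<alpha> j) = (\<Sum>j\<in>J. \<alpha> j)"
    by (subst degree_prod_eq_sum_degree) (auto simp: degree_power_eq)
  moreover have "(\<Prod>j\<in>J. [:- cis (x j), 1:] ^ \<alpha> j) \<noteq> 0"
    using \<open>finite J\<close> by simp
  ultimately have "degree r = 0"
    using r deg assms(4) by (cases "r = 0") (auto simp: degree_mult_eq)
  then obtain r0 where r0: "r = [:r0:]" by (metis degree_0_id degree_eq_zeroE)
  \<comment> \<open>\<open>K\<close> gathers what does not depend on \<open>y\<close>; the powers of
    \<open>cis (y / 2)\<close> multiply to \<open>cis (n * y)\<close>, which cancels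
    \<open>cis (- n * y)\<close>.\<close>
  define K where "K = r0 * (\<Prod>j\<in>J. (2 * \<i> * cis (x j / 2)) ^ \<alpha> j)"
  have "complex_of_real (trig_poly a b n y) = K * complex_of_real (\<Prod>j\<in>J. sin ((y - x j) / 2) ^ \<alpha> j)" for y
  proof -
    have "poly p (cis y) = r0 * (\<Prod>j\<in>J. (cis y - cis (x j)) ^ \<alpha> j)"
      by (simp add: r r0 poly_prod)
    also have "\<dots> = K * (\<Prod>j\<in>J. cis (y / 2) ^ \<alpha> j) * (\<Prod>j\<in>J. complex_of_real (sin ((y - x j) / 2)) ^ \<alpha> j)"
      unfolding cis_diff_eq_sin by (simp add: K_def power_mult_distrib prod.distrib mult_ac)
    also have "(\<Prod>j\<in>J. cis (y / 2) ^ \<alpha> j) = cis (y / 2) ^ (2 * n)"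
      by (simp add: assms(4) flip: power_sum)
    also have "\<dots> = cis (real n * y)" by (simp add: Complex.DeMoivre)
    finally have "poly p (cis y) =
      K * cis (real n * y) * (\<Prod>j\<in>J. complex_of_real (sin ((y - x j) / 2)) ^ \<alpha> j)" .
    then show ?thesis unfolding p
      using cis_mult[of "- (real n * y)" "real n * y"] by (simp add: mult_ac)
  qed
  \<comment> \<open>\<open>K\<close> is complex, but the trigonometric polynomial and the sine
    product are real, so \<open>Re K\<close> serves as the constant.\<close>
  from arg_cong[OF this, of Re]
  have "trig_poly a b n y = Re K * (\<Prod>j\<in>J. sin ((y - x j) / 2) ^ \<alpha> j)" for y
    by (simp del: of_real_prod of_real_power)
  then show thesis using that by blast
qed

section \<open>Error of one iteration step\<close>

text \<open>The bracket divided by \<open>T (y i)\<close> is the difference \<open>L - M\<close> of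
  two logarithmic derivatives. The \<open>i\<close>-th term of \<open>L\<close> yields
  \<open>cot (e / 2)\<close>; the others pair up with \<open>M\<close> into cotangent differences,
  and \<open>B\<close> is the constant in the resulting bound
  \<open>|s| <= B * \<epsilon> / 2\<close>.\<close>

lemma iteration_step_error:
  fixes x y :: "nat \<Rightarrow> real" and \<alpha> :: "nat \<Rightarrow> nat" and A :: real
  assumes T: "T = (\<lambda>t. C * (\<Prod>j\<in>{1..m}. sin ((t - x j) / 2) ^ \<alpha> j))" and "C \<noteq> 0"
    and i: "i \<in> {1..m}" and \<alpha>: "\<alpha> i \<ge> 1" and "A > 0"
    and err: "\<And>j. j \<in> {1..m} \<Longrightarrow> \<bar>y j - x j\<bar> \<le> \<epsilon>"
    and sep: "\<And>j. j \<in> {1..m} - {i} \<Longrightarrow> A \<le> \<bar>sin ((y i - x j) / 2)\<bar>"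
             "\<And>j. j \<in> {1..m} - {i} \<Longrightarrow> A \<le> \<bar>sin ((y i - y j) / 2)\<bar>"
    and B: "B = real (\<Sum>j\<in>{1..m} - {i}. \<alpha> j) / (\<alpha> i * A\<^sup>2)"
    and small: "\<epsilon>\<^sup>2 * (2 * B + 9/8) < 1"
  shows "\<bar>iteration_step T m \<alpha> y i - x i\<bar> \<le> (2 * B + 9/8) * \<epsilon> ^ 3"
proof -
  define e where "e = y i - x i"
  have e_le: "\<bar>e\<bar> \<le> \<epsilon>" using err[OF i] by (simp add: e_def)
  have B0: "B \<ge> 0" unfolding B by (intro divide_nonneg_nonneg of_nat_0_le_iff) auto
  show ?thesis
  proof (cases "e = 0")
    case True
    \<comment> \<open>At an exact root the factor \<open>T (y i)\<close> annihilates the correction,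
      whatever value the inverse takes.\<close>
    then have "T (y i) = 0"
      using i \<alpha> by (auto simp: T e_def intro!: bexI[of _ i])
    then show ?thesis using True B0 e_le by (simp add: iteration_step_def e_def)
  next
    case False
    have "\<epsilon>\<^sup>2 * 1 \<le> \<epsilon>\<^sup>2 * (2 * B + 9/8)" using B0 by (intro mult_left_mono) auto
    then have "\<epsilon>\<^sup>2 < 1\<^sup>2" using small by simp
    then have "\<epsilon> < 1" by (rule power2_less_imp_less) simp
    then have "\<bar>e\<bar> < 1" using e_le by simp
    then have sin_e: "sin (e / 2) \<noteq> 0"
      using False pi_gt3 by (intro sin_half_nonzero) auto
    have nz: "sin ((y i - x j) / 2) \<noteq> 0" if "j \<in> {1..m}" for j
      using sep(1)[of j] that sin_e \<open>A > 0\<close> by (cases "j = i") (auto simp: e_def)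
    have nz': "sin ((y i - y j) / 2) \<noteq> 0" if "j \<in> {1..m} - {i}" for j
      using sep(2)[OF that] \<open>A > 0\<close> by auto
    define L where "L = (\<Sum>j\<in>{1..m}. \<alpha> j / 2 * cot ((y i - x j) / 2))"
    define M where "M = (\<Sum>j\<in>{1..m} - {i}. \<alpha> j / 2 * cot ((y i - y j) / 2))"
    define S where "S = (\<Sum>j\<in>{1..m} - {i}. \<alpha> j / 2 * (cot ((y i - x j) / 2) - cot ((y i - y j) / 2)))"
    define s where "s = 2 * S / \<alpha> i"
    have T0: "T (y i) \<noteq> 0" using \<open>C \<noteq> 0\<close> nz by (simp add: T)
    have Q0: "Q m \<alpha> y i (y i) \<noteq> 0" using nz' by (simp add: Q_def)
    have "(T has_real_derivative T (y i) * L) (at (y i))"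
      using DERIV_cmult[OF DERIV_prod_sin_power[of "{1..m}" "y i" x \<alpha>], of C] nz
      by (simp add: T L_def mult.assoc)
    moreover have "(Q m \<alpha> y i has_real_derivative Q m \<alpha> y i (y i) * M) (at (y i))"
      using DERIV_prod_sin_power[of "{1..m} - {i}" "y i" y \<alpha>] nz'
      by (simp add: Q_def[abs_def] M_def)
    ultimately have "deriv T (y i) = T (y i) * L"
        "deriv (Q m \<alpha> y i) (y i) / Q m \<alpha> y i (y i) = M"
      using Q0 by (simp_all add: DERIV_imp_deriv)
    then have step: "iteration_step T m \<alpha> y i = y i - \<alpha> i / (L - M)"
      using T0 by (simp add: iteration_step_def divide_inverse flip: right_diff_distrib)
    have "L - M = \<alpha> i / 2 * cot (e / 2) + S"
      unfolding L_def M_def S_def e_def sum.remove[OF finite_atLeastAtMost i]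
      by (simp add: right_diff_distrib sum_subtractf)
    also have "\<dots> = \<alpha> i / 2 * (cot (e / 2) + s)" using \<alpha> by (simp add: s_def distrib_left)
    finally have LM: "\<alpha> i / (L - M) = 2 / (cot (e / 2) + s)"
      using \<alpha> by (simp only:) simp
    \<comment> \<open>Each cotangent difference is \<open>sin (v - u) / (sin u * sin v)\<close>,
      where \<open>v - u\<close> is half the error of the \<open>j\<close>-th approximation: the
      numerator is at most \<open>\<epsilon>/2\<close> and the denominator at least
      \<open>A^2\<close> in absolute value.\<close>
    have "\<bar>S\<bar> \<le> (\<Sum>j\<in>{1..m} - {i}. \<alpha> j * (\<epsilon> / (4 * A\<^sup>2)))"
      unfolding S_def
    proof (rule sum_abs[THEN order_trans], rule sum_mono)
      fix j assume j: "j \<in> {1..m} - {i}"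
      let ?u = "(y i - x j) / 2" and ?v = "(y i - y j) / 2"
      have "\<bar>sin (?v - ?u)\<bar> \<le> \<epsilon> / 2"
        using abs_sin_x_le_abs_x[of "?v - ?u"] err[of j] j by (simp add: diff_divide_distrib[symmetric] abs_minus_commute)
      moreover have "A\<^sup>2 \<le> \<bar>sin ?u * sin ?v\<bar>"
        unfolding power2_eq_square abs_mult using \<open>A > 0\<close> by (intro mult_mono sep j) auto
      ultimately have "\<bar>cot ?u - cot ?v\<bar> \<le> (\<epsilon> / 2) / A\<^sup>2"
        unfolding cot_diff[OF nz[of j] nz'[OF j], OF DiffD1[OF j]] abs_divide
        using \<open>A > 0\<close> by (intro frac_le) auto
      then have "\<alpha> j / 2 * \<bar>cot ?u - cot ?v\<bar> \<le> \<alpha> j / 2 * ((\<epsilon> / 2) / A\<^sup>2)"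
        by (intro mult_left_mono) auto
      then show "\<bar>\<alpha> j / 2 * (cot ?u - cot ?v)\<bar> \<le> \<alpha> j * (\<epsilon> / (4 * A\<^sup>2))"
        by (simp add: abs_mult)
    qed
    also have "\<dots> = real (\<Sum>j\<in>{1..m} - {i}. \<alpha> j) * (\<epsilon> / (4 * A\<^sup>2))"
      by (simp add: sum_distrib_right sum_divide_distrib)
    also have "\<dots> = B * \<epsilon> / 4 * \<alpha> i" using \<alpha> \<open>A > 0\<close> by (simp add: B)
    finally have "\<bar>s\<bar> \<le> B * \<epsilon> / 2"
      using \<alpha> by (simp add: s_def abs_mult pos_divide_le_eq)
    from iteration_error_bound[OF False e_le this B0 small] show ?thesis
      unfolding step LM by (simp add: e_def algebra_simps)
  qed
qed

section \<open>Separation of the approximations and the induction on \<open>k\<close>\<close>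

text \<open>Excludes \<open>C = 0\<close> in the factorization: every iterated derivative of the
  zero function is zero.\<close>

lemma root_of_multiplicity_nonzero:
  assumes "root_of_multiplicity f z k"
  shows "f \<noteq> (\<lambda>_. 0)"
proof
  assume f: "f = (\<lambda>_. 0)"
  have "(deriv ^^ j) f = (\<lambda>_. 0)" for j
    by (induction j) (auto simp: f)
  then show False using assms by (simp add: root_of_multiplicity_def)
qed

lemma pairwise_distances_bounds:
  assumes "i \<in> {1..m}" "j \<in> {1..m}" "i \<noteq> j"
  shows "Min (pairwise_distances m x) \<le> \<bar>x i - x j\<bar>"
    and "\<bar>x i - x j\<bar> \<le> Max (pairwise_distances m x)"
proof -
  have "pairwise_distances m x \<subseteq> (\<lambda>(i, j). \<bar>x i - x j\<bar>) ` ({1..m} \<times> {1..m})"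
    by (auto simp: pairwise_distances_def)
  then have "finite (pairwise_distances m x)" by (rule finite_subset) simp
  moreover have "\<bar>x i - x j\<bar> \<in> pairwise_distances m x"
    using assms by (auto simp: pairwise_distances_def)
  ultimately show "Min (pairwise_distances m x) \<le> \<bar>x i - x j\<bar>"
    "\<bar>x i - x j\<bar> \<le> Max (pairwise_distances m x)" by simp_all
qed

theorem theorem2:
  fixes a b :: "nat \<Rightarrow> real" and n m :: nat
    and x :: "nat \<Rightarrow> real" and \<alpha> :: "nat \<Rightarrow> nat"
    and d c q \<xi> A :: real
    and X :: "nat \<Rightarrow> nat \<Rightarrow> real"
  assumes leading: "a n \<noteq> 0 \<or> b n \<noteq> 0"
    and distinct: "inj_on x {1..m}"
    and roots: "\<forall>i\<in>{1..m}. root_of_multiplicity (trig_poly a b n) (x i) (\<alpha> i)"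
    and mult_sum: "(\<Sum>i=1..m. \<alpha> i) = 2 * n"
    and d: "m \<ge> 2 \<longrightarrow> d = Min (pairwise_distances m x)"
    and pos: "c > 0" "q > 0" "\<xi> > 0"
    and q_less: "q < 1"
    and c_xi: "2 * c < \<xi>"
    and d_c: "d - 2 * c > 0"
    and max_dist: "m \<ge> 2 \<longrightarrow> Max (pairwise_distances m x) < 2 * pi - 2 * \<xi>"
    and A: "A = min \<bar>sin (\<xi> / 2)\<bar> \<bar>sin (d / 2 - c)\<bar>"
    and cond: "\<forall>i\<in>{1..m}.
      c\<^sup>2 * (4 * real n + real (\<alpha> i) * (9 * A\<^sup>2 / 8 - 2)) < A\<^sup>2 * real (\<alpha> i)"
    and init: "\<forall>i\<in>{1..m}. \<bar>X 0 i - x i\<bar> \<le> c * q"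
    and iter: "\<forall>k. \<forall>i\<in>{1..m}. X (Suc k) i = iteration_step (trig_poly a b n) m \<alpha> (X k) i"
  shows "\<forall>k. \<forall>i\<in>{1..m}. \<bar>X k i - x i\<bar> \<le> c * q ^ (3 ^ k)"
proof (intro allI)
  let ?T = "trig_poly a b n"
  have dist: "d \<le> \<bar>x i - x j\<bar>" "\<bar>x i - x j\<bar> < 2 * pi - 2 * \<xi>" "\<bar>x i - x j\<bar> > 0"
    if "i \<in> {1..m}" "j \<in> {1..m}" "i \<noteq> j" for i j
  proof -
    \<comment> \<open>Two distinct indices force \<open>m >= 2\<close>, where \<open>Min\<close> and
      \<open>Max\<close> range over a nonempty set.\<close>
    have "m \<ge> 2" using that by auto
    then show "d \<le> \<bar>x i - x j\<bar>" "\<bar>x i - x j\<bar> < 2 * pi - 2 * \<xi>"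
      using pairwise_distances_bounds[OF that, of x] d max_dist by linarith+
    show "\<bar>x i - x j\<bar> > 0"
      using distinct that by (simp add: inj_on_eq_iff)
  qed
  \<comment> \<open>Distances strictly between 0 and \<open>2 * pi\<close> keep the roots distinct
    modulo \<open>2 * pi\<close>, as the factorization requires.\<close>
  have "inj_on (\<lambda>j. cis (x j)) {1..m}"
  proof (rule inj_onI, rule ccontr)
    fix i j assume ij: "i \<in> {1..m}" "j \<in> {1..m}" "cis (x i) = cis (x j)" "i \<noteq> j"
    then have "sin ((x i - x j) / 2) = 0" using cis_diff_eq_sin[of "x i" "x j"] by simp
    then show False
      using dist[OF ij(1,2,4)] sin_half_nonzero[of "x i - x j"] pos by auto
  qed
  then obtain C where C: "?T = (\<lambda>y. C * (\<Prod>j\<in>{1..m}. sin ((y - x j) / 2) ^ \<alpha> j))"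
    using trig_poly_factorization[of "{1..m}" a b n x \<alpha>] roots mult_sum by auto
  fix k
  show "\<forall>i\<in>{1..m}. \<bar>X k i - x i\<bar> \<le> c * q ^ (3 ^ k)"
  proof (induction k)
    case 0
    then show ?case using init by simp
  next
    case (Suc k)
    define \<epsilon> where "\<epsilon> = c * q ^ (3 ^ k)"
    have \<epsilon>: "0 < \<epsilon>" "\<epsilon> \<le> c" using pos q_less by (auto simp: \<epsilon>_def power_le_one mult_left_le)
    have err: "\<bar>X k j - x j\<bar> \<le> \<epsilon>" if "j \<in> {1..m}" for j
      using Suc that by (simp add: \<epsilon>_def)
    show ?case
    proof
      fix i assume i: "i \<in> {1..m}"
      have \<alpha>: "\<alpha> i \<ge> 1" using roots i by (simp add: root_of_multiplicity_def)
      have "C \<noteq> 0" using root_of_multiplicity_nonzero roots i C by fastforce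
      have rest: "real (\<Sum>j\<in>{1..m} - {i}. \<alpha> j) = 2 * real n - \<alpha> i"
        using mult_sum sum.remove[OF finite_atLeastAtMost i, of \<alpha>] by linarith
      have rest0: "0 \<le> 2 * real n - \<alpha> i" using rest by (metis of_nat_0_le_iff)
      \<comment> \<open>For \<open>A = 0\<close> the condition \<open>cond\<close> would read
        \<open>c^2 * (4*n - 2 * \<alpha> i) < 0\<close>, although
        \<open>\<alpha> i <= 2*n\<close>.\<close>
      have "A \<noteq> 0"
      proof
        assume "A = 0"
        then have "c\<^sup>2 * (2 * (2 * real n - \<alpha> i)) < 0" using cond i by (simp add: algebra_simps)
        then show False using rest0 by (simp add: mult_less_0_iff)
      qed
      moreover have "A \<ge> 0" by (simp add: A)
      ultimately have "A > 0" by simp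
      define B where "B = real (\<Sum>j\<in>{1..m} - {i}. \<alpha> j) / (\<alpha> i * A\<^sup>2)"
      have "B \<ge> 0" unfolding B_def by (intro divide_nonneg_nonneg of_nat_0_le_iff) auto
      have BA: "B * (\<alpha> i * A\<^sup>2) = 2 * real n - \<alpha> i"
        unfolding B_def rest using \<alpha> \<open>A > 0\<close> by simp
      \<comment> \<open>Divided by \<open>\<alpha> i * A^2\<close>, the condition
        \<open>cond\<close> becomes \<open>c^2 * (2*B + 9/8) < 1\<close>.\<close>
      have "c\<^sup>2 * (2 * B + 9/8) * (\<alpha> i * A\<^sup>2) = c\<^sup>2 * (2 * (B * (\<alpha> i * A\<^sup>2)) + 9/8 * (\<alpha> i * A\<^sup>2))"
        by (simp only: ring_distribs mult.assoc)
      also have "\<dots> = c\<^sup>2 * (4 * n + \<alpha> i * (9 * A\<^sup>2 / 8 - 2))"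
        unfolding BA by (simp add: algebra_simps)
      also have "\<dots> < 1 * (\<alpha> i * A\<^sup>2)" using cond i by (simp add: mult.commute)
      finally have cB: "c\<^sup>2 * (2 * B + 9/8) < 1"
        using \<alpha> \<open>A > 0\<close> by (subst (asm) mult_less_cancel_right_pos) auto
      have "\<epsilon>\<^sup>2 * (2 * B + 9/8) \<le> c\<^sup>2 * (2 * B + 9/8)"
        using \<epsilon> \<open>B \<ge> 0\<close> by (intro mult_right_mono power_mono) auto
      then have small: "\<epsilon>\<^sup>2 * (2 * B + 9/8) < 1" using cB by linarith
      \<comment> \<open>The two sines in \<open>A\<close> belong to the ends of an interval around
        \<open>|w|/2\<close>: \<open>|w| >= d - 2*c\<close>, and
        \<open>|w| < 2*pi - 2*\<xi> + 2*c < 2*pi - \<xi>\<close> because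
        \<open>2*c < \<xi>\<close>.\<close>
      have sin_ge: "A \<le> \<bar>sin (w / 2)\<bar>"
        if j: "j \<in> {1..m} - {i}" and w: "\<bar>w - (x i - x j)\<bar> \<le> 2 * c" for j w
      proof -
        note ij = dist[of i j]
        have "\<xi> < pi" "d < 2 * pi" using ij i j pos by auto
        then have "A = min (sin (d / 2 - c)) (sin (\<xi> / 2))"
          using pos d_c by (simp add: A min.commute sin_ge_zero)
        also have "\<dots> \<le> sin (\<bar>w\<bar> / 2)"
          using ij i j w d_c c_xi pos by (intro min_sin_le_sin) auto
        also have "\<dots> \<le> \<bar>sin (w / 2)\<bar>" by (cases "w \<ge> 0") auto
        finally show ?thesis .
      qed
      have "\<bar>iteration_step ?T m \<alpha> (X k) i - x i\<bar> \<le> (2 * B + 9/8) * \<epsilon> ^ 3"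
      proof (rule iteration_step_error[OF C \<open>C \<noteq> 0\<close> i \<alpha> \<open>A > 0\<close> err _ _ B_def small])
        fix j assume j: "j \<in> {1..m} - {i}"
        have "\<bar>X k i - x i\<bar> \<le> c" "\<bar>X k j - x j\<bar> \<le> c" using err[of i] err[of j] i j \<epsilon> by auto
        \<comment> \<open>The first difference deviates from \<open>x i - x j\<close> by at most
          \<open>c\<close>, the second by at most \<open>2*c\<close>.\<close>
        then show "A \<le> \<bar>sin ((X k i - x j) / 2)\<bar>" "A \<le> \<bar>sin ((X k i - X k j) / 2)\<bar>"
          using pos by (auto intro!: sin_ge[OF j])
      qed
      \<comment> \<open>Cubing \<open>\<epsilon>\<close> triples the exponent of \<open>q\<close>;
        the surplus factor \<open>c^2\<close> is absorbed by \<open>cB\<close>.\<close>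
      also have "\<dots> = (c\<^sup>2 * (2 * B + 9/8)) * (c * q ^ (3 ^ Suc k))"
        unfolding \<epsilon>_def power_Suc mult.commute[of 3 "3 ^ k"] power_mult
        by (simp add: power_mult_distrib power2_eq_square power3_eq_cube)
      also have "\<dots> \<le> c * q ^ (3 ^ Suc k)"
        using cB pos mult_right_mono[of "c\<^sup>2 * (2 * B + 9/8)" 1 "c * q ^ (3 ^ Suc k)"] by simp
      finally show "\<bar>X (Suc k) i - x i\<bar> \<le> c * q ^ (3 ^ Suc k)" using iter i by simp
    qed
  qed
qed

end
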